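(* Let $G$ be a group, $U$ a set, and $f_G:G\to P(U)$ a soft set. Then $f_G$ is a normal soft int-group in $G$ if and only if for every $\alpha\in P(U)$ such that $f_G^{\alpha}=\{x\in G: f_G(x)\supseteq\alpha\}$ is nonempty, $f_G^{\alpha}$ is a normal subgroup of $G$.
   Context: Let $U$ be a set with power set $P(U)$ and $G$ a group. A soft set $f_G$ over $U$ with parameter set $G$ is a function $f_G:G\to P(U)$. It is a soft int-group in $G$ if $f_G(xy)\supseteq f_G(x)\cap f_G(y)$ and $f_G(x^{-1})=f_G(x)$ for all $x,y\in G$. A soft int-group $f_G$ is a normal soft int-group if in addition $f_G(xy)=f_G(yx)$ for all $x,y\in G$. The set $f_G^\alpha$ is called the $\alpha$-inclusion of $f_G$. *)

theory Defs
  imports "HOL-Algebra.Coset"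
begin

text \<open>A soft set is a map from the carrier of \<open>G\<close> to the power set of \<open>U\<close>;
  its values outside the carrier are irrelevant and left unconstrained.\<close>

definition soft_set :: "'u set \<Rightarrow> ('a, 'm) monoid_scheme \<Rightarrow> ('a \<Rightarrow> 'u set) \<Rightarrow> bool" where
  "soft_set U G f \<longleftrightarrow> f \<in> carrier G \<rightarrow> Pow U"

definition soft_int_group :: "'u set \<Rightarrow> ('a, 'm) monoid_scheme \<Rightarrow> ('a \<Rightarrow> 'u set) \<Rightarrow> bool" where
  "soft_int_group U G f \<longleftrightarrow>
     soft_set U G f \<and>
     (\<forall>x\<in>carrier G. \<forall>y\<in>carrier G. f x \<inter> f y \<subseteq> f (x \<otimes>\<^bsub>G\<^esub> y)) \<and>
     (\<forall>x\<in>carrier G. f (inv\<^bsub>G\<^esub> x) = f x)"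

definition normal_soft_int_group :: "'u set \<Rightarrow> ('a, 'm) monoid_scheme \<Rightarrow> ('a \<Rightarrow> 'u set) \<Rightarrow> bool" where
  "normal_soft_int_group U G f \<longleftrightarrow>
     soft_int_group U G f \<and>
     (\<forall>x\<in>carrier G. \<forall>y\<in>carrier G. f (x \<otimes>\<^bsub>G\<^esub> y) = f (y \<otimes>\<^bsub>G\<^esub> x))"

definition inclusion_set :: "('a, 'm) monoid_scheme \<Rightarrow> ('a \<Rightarrow> 'u set) \<Rightarrow> 'u set \<Rightarrow> 'a set" where
  "inclusion_set G f \<alpha> = {x \<in> carrier G. \<alpha> \<subseteq> f x}"

end

theory Submission
  imports Defs
begin

text \<open>Each closure property of the inclusions corresponds to one law of \<open>f\<close>. If
  \<open>f\<close> obeys the laws, a bound \<alpha> below \<open>f x\<close> and \<open>f y\<close>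
  passes to products and inverses, and commutation under \<open>f\<close> makes \<open>f\<close>
  constant on conjugacy classes, so every nonempty inclusion is a normal subgroup. Conversely,
  \<open>x\<close> lies in the inclusion at level \<alpha> exactly when \<alpha> is below
  \<open>f x\<close>; so each law is recovered by taking as level the very set that the law bounds
  from below (\<open>normal_soft_int_groupI\<close>).\<close>

lemma (in group) normal_soft_int_group_imp_normal:
  assumes f: "normal_soft_int_group U G f" and ne: "inclusion_set G f \<alpha> \<noteq> {}"
  shows "inclusion_set G f \<alpha> \<lhd> G"
proof -
  have mult: "f x \<inter> f y \<subseteq> f (x \<otimes> y)" if "x \<in> carrier G" "y \<in> carrier G" for x y
    using f that by (auto simp: normal_soft_int_group_def soft_int_group_def)
  have inv: "f (inv x) = f x" if "x \<in> carrier G" for x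
    using f that by (auto simp: normal_soft_int_group_def soft_int_group_def)
  have comm: "f (x \<otimes> y) = f (y \<otimes> x)" if "x \<in> carrier G" "y \<in> carrier G" for x y
    using f that by (auto simp: normal_soft_int_group_def)
  have "subgroup (inclusion_set G f \<alpha>) G"
  proof (rule subgroupI[OF _ ne])
    show "x \<otimes> y \<in> inclusion_set G f \<alpha>"
      if "x \<in> inclusion_set G f \<alpha>" "y \<in> inclusion_set G f \<alpha>" for x y
      using that mult[of x y] by (auto simp: inclusion_set_def)
  qed (auto simp: inclusion_set_def inv)
  moreover have "x \<otimes> h \<otimes> inv x \<in> inclusion_set G f \<alpha>"
    if "x \<in> carrier G" "h \<in> inclusion_set G f \<alpha>" for x h
  proof -
    have h: "h \<in> carrier G" "\<alpha> \<subseteq> f h"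
      using that by (auto simp: inclusion_set_def)
    \<comment> \<open>Moving the factor \<open>inv x\<close> to the front under \<open>f\<close>
      cancels the conjugation.\<close>
    have "f (x \<otimes> h \<otimes> inv x) = f (inv x \<otimes> (x \<otimes> h))"
      using that h by (intro comm) auto
    also have "inv x \<otimes> (x \<otimes> h) = h"
      using that h by (simp add: inv_solve_left')
    finally show ?thesis
      using that h by (simp add: inclusion_set_def)
  qed
  ultimately show ?thesis
    by (simp add: normal_inv_iff)
qed

lemma (in group) normal_soft_int_groupI:
  assumes f: "soft_set U G f"
    and N: "\<And>\<alpha>. \<alpha> \<subseteq> U \<Longrightarrow> inclusion_set G f \<alpha> \<noteq> {} \<Longrightarrow> inclusion_set G f \<alpha> \<lhd> G"
  shows "normal_soft_int_group U G f"
proof -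
  \<comment> \<open>A level below some value \<open>f x\<close> is admissible: it lies in
    \<open>U\<close> because \<open>f x\<close> does, and \<open>x\<close> witnesses
    nonemptiness.\<close>
  have normal: "inclusion_set G f \<alpha> \<lhd> G" if "x \<in> carrier G" "\<alpha> \<subseteq> f x" for \<alpha> x
  proof (rule N)
    show "\<alpha> \<subseteq> U" using f that by (auto simp: soft_set_def Pi_iff)
    show "inclusion_set G f \<alpha> \<noteq> {}" using that by (auto simp: inclusion_set_def)
  qed
  have mult: "f x \<inter> f y \<subseteq> f (x \<otimes> y)" if "x \<in> carrier G" "y \<in> carrier G" for x y
  proof -
    \<comment> \<open>The level \<open>f x \<inter> f y\<close> is the largest whose inclusion
      contains both \<open>x\<close> and \<open>y\<close>.\<close>
    have "subgroup (inclusion_set G f (f x \<inter> f y)) G"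
      using normal[of x "f x \<inter> f y"] that by (simp add: normal_imp_subgroup)
    then have "x \<otimes> y \<in> inclusion_set G f (f x \<inter> f y)"
      by (rule subgroup.m_closed) (use that in \<open>auto simp: inclusion_set_def\<close>)
    then show ?thesis by (simp add: inclusion_set_def)
  qed
  have inv_le: "f x \<subseteq> f (inv x)" if "x \<in> carrier G" for x
  proof -
    have "subgroup (inclusion_set G f (f x)) G"
      using normal[of x "f x"] that by (simp add: normal_imp_subgroup)
    then have "inv x \<in> inclusion_set G f (f x)"
      by (rule subgroup.m_inv_closed) (use that in \<open>auto simp: inclusion_set_def\<close>)
    then show ?thesis by (simp add: inclusion_set_def)
  qed
  \<comment> \<open>The reverse inclusion is \<open>inv_le\<close> at \<open>inv x\<close>, since
    inversion is an involution.\<close>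
  have inv: "f (inv x) = f x" if "x \<in> carrier G" for x
    using inv_le[of x] inv_le[of "inv x"] that by simp
  have comm_le: "f (x \<otimes> y) \<subseteq> f (y \<otimes> x)" if "x \<in> carrier G" "y \<in> carrier G" for x y
  proof -
    have "x \<otimes> y \<in> inclusion_set G f (f (x \<otimes> y))"
      using that by (simp add: inclusion_set_def)
    \<comment> \<open>Normality enters here: \<open>y \<otimes> x\<close> is the conjugate of
      \<open>x \<otimes> y\<close> by \<open>y\<close>, so it stays in the inclusion at level
      \<open>f (x \<otimes> y)\<close>.\<close>
    with normal[of "x \<otimes> y" "f (x \<otimes> y)"]
    have "y \<otimes> (x \<otimes> y) \<otimes> inv y \<in> inclusion_set G f (f (x \<otimes> y))"
      using that by (simp add: normal_inv_iff)
    moreover have "y \<otimes> (x \<otimes> y) \<otimes> inv y = y \<otimes> x"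
      using that by (simp add: m_assoc)
    ultimately show ?thesis by (simp add: inclusion_set_def)
  qed
  show ?thesis
    unfolding normal_soft_int_group_def soft_int_group_def
    \<comment> \<open>Equality in the commutation law comes from \<open>comm_le\<close> used twice,
      with \<open>x\<close> and \<open>y\<close> exchanged.\<close>
    by (intro conjI ballI f mult inv equalityI comm_le)
qed

theorem theorem3p15:
  fixes G :: "('a, 'm) monoid_scheme" and U :: "'u set" and f :: "'a \<Rightarrow> 'u set"
  assumes "group G"
    and "soft_set U G f"
  shows "normal_soft_int_group U G f \<longleftrightarrow>
    (\<forall>\<alpha>\<in>Pow U. inclusion_set G f \<alpha> \<noteq> {} \<longrightarrow> inclusion_set G f \<alpha> \<lhd> G)"
  using group.normal_soft_int_group_imp_normal[OF assms(1)]
    group.normal_soft_int_groupI[OF assms]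
  by blast

end
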